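(* The construction described in the context contains all isogonal matchings. That is: suppose that for $i=1,2,3,4$ the real numbers $a_i,e_i\ne0$, $b_i=c_i=0$ and $f_i\in(-1,1]$ satisfy the standing inequalities and that the associated ideal $M=(G^{(1)},G^{(2)},G^{(3)},G^{(4)})$ is a matching (i.e. $Z(M)$ is infinite). Then, starting the construction from the free parameters $(a_1,e_1,a_2,e_2,a_3,e_3,a_4,f_1,f_2)$, for suitable choices of the signs $\pm$ and of $F_3$ the construction produces exactly the given values of $f_3$, $f_4$ and $e_4$.
   Context: Indices are taken modulo 4 (so $x_5=x_1$). For each $i\in\{1,2,3,4\}$ one has real coefficients $a_i,b_i,c_i,e_i$ and $f_i\in(-1,1]$, with the standing inequalities $$(1-4a_ie_i-4b_ic_i)^2>64a_ib_ic_ie_i,\qquad |b_i+c_i-a_i-e_i|<1.$$ Define $g^{(i)}(x_i,y_i)=a_ix_i^2y_i^2+b_ix_i^2+c_iy_i^2+x_iy_i+e_i$, $h^{(i)}(y_i,x_{i+1})=(1-f_i^2)(y_i-x_{i+1})-2f_i(y_ix_{i+1}+1)$, and $$G^{(i)}(x_i,x_{i+1})=\mathrm{Res}(g^{(i)},h^{(i)};y_i).$$ The zero set $Z(M)\subset(\mathbb{C}P^1)^4$ of $M=(G^{(1)},G^{(2)},G^{(3)},G^{(4)})$ is the set of points at which all $G^{(i)}$ vanish, zeros with some coordinate $\infty$ being understood by homogenizing $G^{(i)}$ to bidegree $(2,2)$ in $(x_i,x_{i+1})$. $M$ is a matching if $Z(M)$ is infinite. An isogonal matching is a matching with $b_i=c_i=0$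 and $a_ie_i\neq0$ for all $i$. Construction. Take as free parameters nonzero reals $a_1,e_1,a_2,e_2,a_3,e_3,a_4$ and $f_1,f_2\in(-1,1]$; the quantities $e_4,f_3,f_4$ are to be determined. For $i=1,2,3$ set $k_i=\frac{-1\pm\sqrt{1-4a_ie_i}}{2a_i}$ (signs free) and for $i=1,2$ set $N_i=\begin{pmatrix} -2f_i & k_i(1-f_i^2) \\ 1-f_i^2 & 2k_if_i \end{pmatrix}$. Let $$A=\frac{2(us+vt)}{s^2+t^2-u^2-v^2}\quad\text{where}\quad \begin{pmatrix} u & v \\ s & t \end{pmatrix}=\begin{pmatrix} 0 & k_3 \\ 1 & 0 \end{pmatrix}N_2N_1.$$ Let $F_3\in\mathbb{R}P^1$ and $f_3\in(-1,1]$ be such that $\frac{2F_3}{1-F_3^2}=A$ and $\frac{2f_3}{1-f_3^2}=F_3$ (here $x\mapsto\frac{2x}{1-x^2}$ is regarded as a map $\mathbb{R}P^1\to\mathbb{R}P^1$, sending $\pm1\mapsto\infty$ and $\infty\mapsto0$). Set $$\begin{pmatrix} u' & v' \\ s' & t' \end{pmatrix}=\begin{pmatrix} 1-f_3^2 & -2f_3 \\ 2f_3 & 1-f_3^2 \end{pmatrix}\begin{pmatrix} u & v \\ s & t \end{pmatrix},$$ let $(k_4,F_4)=\left(\frac{v'}{s'},\frac{t'}{s'}\right)$ if $s'\ne0$ and $(k_4,F_4)=\left(-\frac{u'}{t'},\infty\right)$ otherwise, let $f_4\in(-1,1]$ be such that $\frac{2f_4}{1-f_4^2}=F_4$, and set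 $e_4=-a_4k_4^2-k_4$, where the value of $a_4$ is adjusted so that $e_4\neq0$. One starts over if the standing inequalities fail for some $i$. *)

theory Defs
  imports Complex_Main "HOL-Library.Numeral_Type" "Subresultants.Resultant_Prelim"
begin

text \<open>
  Cyclic indices modulo 4 are elements of the numeral type \<open>4\<close>, the ring of integers
  modulo 4: \<open>i + 1\<close> wraps around and \<open>4 = 0\<close>.  A family \<open>(a\<^sub>1, a\<^sub>2, a\<^sub>3, a\<^sub>4)\<close> is a
  function \<open>a\<close> on this type with values \<open>a 1\<close>, \<open>a 2\<close>, \<open>a 3\<close>, \<open>a 4\<close>.
\<close>

definition standing_ineq :: "real \<Rightarrow> real \<Rightarrow> real \<Rightarrow> real \<Rightarrow> bool" where
  "standing_ineq a b c e \<longleftrightarrow>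
     (1 - 4*a*e - 4*b*c)^2 > 64*a*b*c*e \<and> \<bar>b + c - a - e\<bar> < 1"


subsection \<open>Projective lines\<close>

datatype 'a proj_line = Affine 'a | Infinity

fun hom_coords :: "'a::zero_neq_one proj_line \<Rightarrow> 'a \<times> 'a" where
  "hom_coords (Affine x) = (x, 1)"
| "hom_coords Infinity = (1, 0)"

text \<open>The point \<open>p / q\<close>; meaningful only if \<open>p\<close> and \<open>q\<close> are not both zero.\<close>

definition proj_ratio :: "'a::field \<Rightarrow> 'a \<Rightarrow> 'a proj_line" where
  "proj_ratio p q = (if q = 0 then Infinity else Affine (p / q))"

text \<open>The map \<open>x \<mapsto> 2x / (1 - x\<^sup>2)\<close> from the real projective line to itself.\<close>

fun tan_double :: "real proj_line \<Rightarrow> real proj_line" where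
  "tan_double (Affine x) = proj_ratio (2*x) (1 - x^2)"
| "tan_double Infinity = Affine 0"


subsection \<open>The resultants and their common zeros\<close>

text \<open>
  The variables \<open>x = x\<^sub>i\<close>, \<open>x' = x\<^bsub>i+1\<^esub>\<close> and \<open>y = y\<^sub>i\<close>: a polynomial in them is a polynomial
  in \<open>y\<close> whose coefficients are polynomials in \<open>x'\<close> whose coefficients are polynomials in
  \<open>x\<close>.  So the resultant, taken in the outermost variable, eliminates \<open>y\<close>.
\<close>

type_synonym poly3 = "complex poly poly poly"

abbreviation cst :: "real \<Rightarrow> poly3" where "cst r \<equiv> [:[:[:complex_of_real r:]:]:]"
abbreviation varx :: poly3 where "varx \<equiv> [:[:[:0, 1:]:]:]"
abbreviation varx' :: poly3 where "varx' \<equiv> [:[:0, 1:]:]"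
abbreviation vary :: poly3 where "vary \<equiv> [:0, 1:]"

definition g_poly :: "real \<Rightarrow> real \<Rightarrow> real \<Rightarrow> real \<Rightarrow> poly3" where
  "g_poly a b c e =
     cst a * varx^2 * vary^2 + cst b * varx^2 + cst c * vary^2 + varx * vary + cst e"

definition h_poly :: "real \<Rightarrow> poly3" where
  "h_poly f = cst (1 - f^2) * (vary - varx') - cst (2*f) * (vary * varx' + 1)"

definition G_poly :: "real \<Rightarrow> real \<Rightarrow> real \<Rightarrow> real \<Rightarrow> real \<Rightarrow> complex poly poly" where
  "G_poly a b c e f = resultant (g_poly a b c e) (h_poly f)"

text \<open>
  Value at a pair of points of the projective line of the homogenization to bidegree
  \<open>(2,2)\<close>; \<open>coeff (coeff G k) j\<close> is the coefficient of \<open>x\<^sup>j x'\<^sup>k\<close>.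
\<close>

definition bihom_eval ::
  "'a::comm_ring_1 poly poly \<Rightarrow> 'a proj_line \<Rightarrow> 'a proj_line \<Rightarrow> 'a" where
  "bihom_eval G P Q =
     (case (hom_coords P, hom_coords Q) of ((x, w), (x', w')) \<Rightarrow>
        \<Sum>j\<le>2. \<Sum>k\<le>2. coeff (coeff G k) j * x^j * w^(2-j) * x'^k * w'^(2-k))"

definition zero_set ::
  "(4 \<Rightarrow> real) \<Rightarrow> (4 \<Rightarrow> real) \<Rightarrow> (4 \<Rightarrow> real) \<Rightarrow> (4 \<Rightarrow> real) \<Rightarrow> (4 \<Rightarrow> real)
     \<Rightarrow> (4 \<Rightarrow> complex proj_line) set" where
  "zero_set a b c e f =
     {x. \<forall>i. bihom_eval (G_poly (a i) (b i) (c i) (e i) (f i)) (x i) (x (i + 1)) = 0}"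

definition matching ::
  "(4 \<Rightarrow> real) \<Rightarrow> (4 \<Rightarrow> real) \<Rightarrow> (4 \<Rightarrow> real) \<Rightarrow> (4 \<Rightarrow> real) \<Rightarrow> (4 \<Rightarrow> real) \<Rightarrow> bool" where
  "matching a b c e f \<longleftrightarrow> infinite (zero_set a b c e f)"

definition isogonal_matching ::
  "(4 \<Rightarrow> real) \<Rightarrow> (4 \<Rightarrow> real) \<Rightarrow> (4 \<Rightarrow> real) \<Rightarrow> (4 \<Rightarrow> real) \<Rightarrow> (4 \<Rightarrow> real) \<Rightarrow> bool" where
  "isogonal_matching a b c e f \<longleftrightarrow>
     matching a b c e f \<and> (\<forall>i. b i = 0 \<and> c i = 0 \<and> a i * e i \<noteq> 0)"


subsection \<open>The construction\<close>

definition k_root :: "real \<Rightarrow> real \<Rightarrow> real \<Rightarrow> real" where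
  "k_root \<sigma> a e = (-1 + \<sigma> * sqrt (1 - 4*a*e)) / (2*a)"

definition N_mat :: "real \<Rightarrow> real \<Rightarrow> real mat" where
  "N_mat k f = mat_of_rows_list 2 [[-2*f, k*(1 - f^2)], [1 - f^2, 2*k*f]]"

text \<open>
  \<open>isogonal_construction a\<^sub>1 e\<^sub>1 a\<^sub>2 e\<^sub>2 a\<^sub>3 e\<^sub>3 a\<^sub>4 f\<^sub>1 f\<^sub>2 \<sigma>\<^sub>1 \<sigma>\<^sub>2 \<sigma>\<^sub>3 F\<^sub>3 f\<^sub>3 f\<^sub>4 e\<^sub>4\<close>: run on the free
  parameters \<open>a\<^sub>1, \<dots>, f\<^sub>2\<close> with the choices \<open>\<sigma>\<^sub>1, \<sigma>\<^sub>2, \<sigma>\<^sub>3, F\<^sub>3\<close>, where \<open>\<sigma>\<^sub>i\<close> is the sign in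
  \<open>k\<^sub>i\<close>, the construction goes through and returns \<open>f\<^sub>3, f\<^sub>4, e\<^sub>4\<close>.  In particular \<open>A\<close> must
  be defined, that is, not of the form \<open>0/0\<close>, and the run must not end in a restart.  The
  adjustment of \<open>a\<^sub>4\<close> appears as the condition \<open>e\<^sub>4 \<noteq> 0\<close> for the \<open>a\<^sub>4\<close> supplied.
\<close>

definition isogonal_construction ::
  "real \<Rightarrow> real \<Rightarrow> real \<Rightarrow> real \<Rightarrow> real \<Rightarrow> real \<Rightarrow> real \<Rightarrow> real \<Rightarrow> real
     \<Rightarrow> real \<Rightarrow> real \<Rightarrow> real \<Rightarrow> real proj_line \<Rightarrow> real \<Rightarrow> real \<Rightarrow> real \<Rightarrow> bool" where
  "isogonal_construction a1 e1 a2 e2 a3 e3 a4 f1 f2 \<sigma>1 \<sigma>2 \<sigma>3 F3 f3 f4 e4 \<longleftrightarrow>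
     a1 \<noteq> 0 \<and> e1 \<noteq> 0 \<and> a2 \<noteq> 0 \<and> e2 \<noteq> 0 \<and> a3 \<noteq> 0 \<and> e3 \<noteq> 0 \<and> a4 \<noteq> 0 \<and>
     f1 \<in> {-1<..1} \<and> f2 \<in> {-1<..1} \<and>
     \<sigma>1 \<in> {-1, 1} \<and> \<sigma>2 \<in> {-1, 1} \<and> \<sigma>3 \<in> {-1, 1} \<and>
     (let k1 = k_root \<sigma>1 a1 e1;
          k2 = k_root \<sigma>2 a2 e2;
          k3 = k_root \<sigma>3 a3 e3;
          B = mat_of_rows_list 2 [[0, k3], [1, 0]] * N_mat k2 f2 * N_mat k1 f1;
          u = B $$ (0,0); v = B $$ (0,1); s = B $$ (1,0); t = B $$ (1,1);
          A_num = 2*(u*s + v*t);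
          A_den = s^2 + t^2 - u^2 - v^2;
          B' = mat_of_rows_list 2 [[1 - f3^2, -2*f3], [2*f3, 1 - f3^2]] * B;
          u' = B' $$ (0,0); v' = B' $$ (0,1); s' = B' $$ (1,0); t' = B' $$ (1,1);
          (k4, F4) = (if s' \<noteq> 0 then (v'/s', Affine (t'/s')) else (-u'/t', Infinity))
      in (A_num, A_den) \<noteq> (0, 0) \<and>
         tan_double F3 = proj_ratio A_num A_den \<and>
         f3 \<in> {-1<..1} \<and> tan_double (Affine f3) = F3 \<and>
         f4 \<in> {-1<..1} \<and> tan_double (Affine f4) = F4 \<and>
         e4 = -a4*k4^2 - k4 \<and> e4 \<noteq> 0) \<and>
     standing_ineq a1 0 0 e1 \<and> standing_ineq a2 0 0 e2 \<and>
     standing_ineq a3 0 0 e3 \<and> standing_ineq a4 0 0 e4"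

end

theory Submission
  imports Defs
begin

text \<open>
  With \<open>b = c = 0\<close> the polynomial \<open>g\<close> is \<open>a (xy)\<^sup>2 + xy + e\<close>, a quadratic in the product \<open>xy\<close>.
  Its values at \<open>xy = 1\<close> and \<open>xy = -1\<close> are \<open>a + e + 1 > 0\<close> and \<open>a + e - 1 < 0\<close>, so \<open>g = 0\<close> means
  \<open>xy = k\<close> for one of two real roots \<open>k\<close>, and neither root is \<open>\<plusminus>1\<close>.  The equation \<open>h = 0\<close> says that
  \<open>x'\<close> is the image of \<open>y\<close> under the rotation with matrix rows \<open>(1 - f\<^sup>2, -2f)\<close> and
  \<open>(2f, 1 - f\<^sup>2)\<close>.  Eliminating \<open>y\<close>, the zero set of \<open>G\<close> is the union of the graphs of two
  Moebius transformations, whose matrices are \<open>N\<close> for the two values of \<open>k\<close>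
  (\<open>bihom_eval_G_poly\<close>, \<open>G_zero_imp_mobius_rel\<close>).

  If there are infinitely many zeros, then some choice of the four roots is used by infinitely
  many of them.  Such a zero is determined by its first coordinate, which is a fixed point of
  \<open>N\<^sub>4 N\<^sub>3 N\<^sub>2 N\<^sub>1\<close>.  A Moebius transformation with infinitely many fixed points is the identity,
  so this product is a scalar matrix (\<open>infinite_closed_chains_imp_scalar\<close>), and \<open>N\<^sub>3 N\<^sub>2 N\<^sub>1\<close> is a
  nonzero multiple of the adjugate of \<open>N\<^sub>4\<close>.

  Now \<open>N\<^sub>3 N\<^sub>2 N\<^sub>1\<close> is the matrix with entries \<open>u', v', s', t'\<close> of the construction, that is, the
  rotation given by \<open>f\<^sub>3\<close> times the matrix with entries \<open>u, v, s, t\<close>.  Comparing it with the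
  adjugate of \<open>N\<^sub>4\<close> gives the formulas for \<open>k\<^sub>4\<close> and \<open>F\<^sub>4\<close>.  Moreover the rows of that adjugate
  are orthogonal, and the requirement that the rotation make the rows \<open>(u, v)\<close> and \<open>(s, t)\<close>
  orthogonal prescribes the tangent of twice its angle to be \<open>A\<close>
  (\<open>rotation_making_rows_orthogonal\<close>).  The value \<open>A\<close> would be \<open>0/0\<close> only for orthogonal rows of
  equal length, which \<open>k\<^sub>4\<^sup>2 \<noteq> 1\<close> excludes.
\<close>

section \<open>The resultant as a quadratic form\<close>

lemma det_2:
  fixes A :: "'a::comm_ring_1 mat"
  assumes A: "A \<in> carrier_mat 2 2"
  shows "det A = A $$ (0,0) * A $$ (1,1) - A $$ (0,1) * A $$ (1,0)"
  using A by (simp add: laplace_expansion_row[OF A, of 0] cofactor_def mat_delete_def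
      numeral_2_eq_2 det_single)

lemma det_3:
  fixes A :: "'a::comm_ring_1 mat"
  assumes A: "A \<in> carrier_mat 3 3"
  shows "det A = A $$ (0,0) * (A $$ (1,1) * A $$ (2,2) - A $$ (1,2) * A $$ (2,1))
    - A $$ (0,1) * (A $$ (1,0) * A $$ (2,2) - A $$ (1,2) * A $$ (2,0))
    + A $$ (0,2) * (A $$ (1,0) * A $$ (2,1) - A $$ (1,1) * A $$ (2,0))"
proof -
  have minor: "mat_delete A 0 j \<in> carrier_mat 2 2" for j
    using mat_delete_carrier[OF A, of 0 j] by simp
  have "det (mat_delete A 0 0) = A $$ (1,1) * A $$ (2,2) - A $$ (1,2) * A $$ (2,1)"
    "det (mat_delete A 0 (Suc 0)) = A $$ (1,0) * A $$ (2,2) - A $$ (1,2) * A $$ (2,0)"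
    "det (mat_delete A 0 (Suc (Suc 0))) = A $$ (1,0) * A $$ (2,1) - A $$ (1,1) * A $$ (2,0)"
    unfolding det_2[OF minor] using A by (simp_all add: mat_delete_def numeral_2_eq_2)
  then show ?thesis
    by (simp add: laplace_expansion_row[OF A, of 0] cofactor_def numeral_3_eq_3 numeral_2_eq_2
        lessThan_Suc right_diff_distrib)
qed

lemma resultant_quadratic_linear:
  fixes c0 c1 c2 h0 h1 :: "'a::comm_ring_1"
  assumes "c2 \<noteq> 0" "h1 \<noteq> 0"
  shows "resultant [:c0, c1, c2:] [:h0, h1:] = c2*h0^2 - c1*h0*h1 + c0*h1^2"
proof -
  let ?p = "[:c0, c1, c2:]" and ?q = "[:h0, h1:]"
  have dim: "degree ?p = 2" "degree ?q = 1"
    using assms by simp_all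
  have S: "sylvester_mat ?p ?q \<in> carrier_mat 3 3"
    using sylvester_carrier_mat[of ?p ?q] unfolding dim by simp
  show ?thesis
    unfolding resultant_def det_3[OF S]
    by (simp add: sylvester_index_mat dim[unfolded One_nat_def] eval_nat_numeral algebra_simps
        del: degree_pCons_eq_if)
qed

lemma half_angle_nonzero: "(1 - f^2, 2*f) \<noteq> (0, 0)" for f :: real
  by auto

text \<open>
  The resultant substitutes into \<open>g\<close> the root \<open>y = (c x' + d) / (c - d x')\<close> of the linear
  polynomial \<open>h\<close>, where \<open>c = 1 - f\<^sup>2\<close> and \<open>d = 2f\<close>, and clears denominators.  The result is the
  quadratic \<open>a z\<^sup>2 + z + e\<close> homogenized, evaluated at the ratio \<open>z = xy\<close>.
\<close>

lemma bihom_eval_G_poly: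
  fixes a e f :: real and c d :: complex
  assumes a: "a \<noteq> 0" and P: "hom_coords P = (x, w)" and Q: "hom_coords Q = (x', w')"
  defines "c \<equiv> of_real (1 - f^2)" and "d \<equiv> of_real (2*f)"
  shows "bihom_eval (G_poly a 0 0 e f) P Q =
     a * (x * (c*x' + d*w'))^2 + (x * (c*x' + d*w')) * (w * (c*w' - d*x'))
     + e * (w * (c*w' - d*x'))^2"
proof -
  have g: "g_poly a 0 0 e = [: [:[:of_real e:]:], [:[:0, 1:]:], [:[:0, 0, of_real a:]:] :]"
    by (simp add: g_poly_def power2_eq_square)
  have h: "h_poly f = [: [:[:-d:], [:-c:]:], [:[:c:], [:-d:]:] :]"
    by (simp add: h_poly_def c_def d_def one_pCons)
  (* h stays linear in y for every f, in particular for f = 1, where c = 0. *)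
  have h1: "[:[:c:], [:-d:]:] \<noteq> 0"
    using half_angle_nonzero[of f] by (auto simp: c_def d_def simp del: of_real_mult of_real_diff)
  have "G_poly a 0 0 e f =
      [:[:0, 0, of_real a:]:] * [:[:-d:], [:-c:]:]^2
      - [:[:0, 1:]:] * [:[:-d:], [:-c:]:] * [:[:c:], [:-d:]:]
      + [:[:of_real e:]:] * [:[:c:], [:-d:]:]^2"
    unfolding G_poly_def g h using a by (intro resultant_quadratic_linear h1) simp
  also have "\<dots> = [: [: e * c^2, c*d, a * d^2 :],
                    [: -2 * e * c * d, c^2 - d^2, 2 * a * c * d :],
                    [: e * d^2, -c*d, a * c^2 :] :]"
    by (simp add: power2_eq_square algebra_simps)
  finally show ?thesis
    unfolding bihom_eval_def P Q
    by (simp add: numeral_2_eq_2 algebra_simps)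
qed

section \<open>Fractional linear correspondences\<close>

text \<open>
  The graph of the Moebius transformation of \<open>M\<close>, written as a cross product so that the point at
  infinity needs no case distinction and real matrices act on the complex projective line.
\<close>

definition mobius_rel :: "real mat \<Rightarrow> complex proj_line \<Rightarrow> complex proj_line \<Rightarrow> bool" where
  "mobius_rel M P Q \<longleftrightarrow> (case (hom_coords P, hom_coords Q) of ((x, w), (x', w')) \<Rightarrow>
     x' * (M $$ (1,0) * x + M $$ (1,1) * w) = w' * (M $$ (0,0) * x + M $$ (0,1) * w))"

lemma mult_mat_2_index:
  fixes A B :: "'a::comm_semiring_0 mat"
  assumes "A \<in> carrier_mat 2 2" "B \<in> carrier_mat 2 2" "i < 2" "j < 2"
  shows "(A * B) $$ (i,j) = A $$ (i,0) * B $$ (0,j) + A $$ (i,1) * B $$ (1,j)"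
  using assms by (auto simp: scalar_prod_def numeral_2_eq_2)

lemma mobius_rel_mult:
  assumes "M \<in> carrier_mat 2 2" "M' \<in> carrier_mat 2 2" "mobius_rel M P Q" "mobius_rel M' Q R"
  shows "mobius_rel (M' * M) P R"
proof (cases Q)
  case (Affine y)
  obtain x w where P: "hom_coords P = (x, w)" by fastforce
  obtain x'' w'' where R: "hom_coords R = (x'', w'')" by fastforce
  define s where "s = M $$ (1,0) * x + M $$ (1,1) * w"
  have 1: "y * s = M $$ (0,0) * x + M $$ (0,1) * w"
    using assms(3) P Affine by (simp add: mobius_rel_def s_def)
  have 2: "x'' * (M' $$ (1,0) * y + M' $$ (1,1)) = w'' * (M' $$ (0,0) * y + M' $$ (0,1))"
    using assms(4) R Affine by (simp add: mobius_rel_def)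
  have "x'' * (M' $$ (1,0) * (y * s) + M' $$ (1,1) * s)
      = w'' * (M' $$ (0,0) * (y * s) + M' $$ (0,1) * s)"
    using arg_cong[OF 2, of "\<lambda>z. z * s"] by (simp add: algebra_simps)
  then show ?thesis
    unfolding 1 using assms(1,2) P R
    by (simp add: mobius_rel_def mult_mat_2_index s_def algebra_simps del: index_mult_mat)
next
  case Infinity
  obtain x w where P: "hom_coords P = (x, w)" by fastforce
  obtain x'' w'' where R: "hom_coords R = (x'', w'')" by fastforce
  define p where "p = M $$ (0,0) * x + M $$ (0,1) * w"
  define s where "s = M $$ (1,0) * x + M $$ (1,1) * w"
  have 1: "s = 0"
    using assms(3) P Infinity by (simp add: mobius_rel_def s_def)
  have 2: "x'' * M' $$ (1,0) = w'' * M' $$ (0,0)"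
    using assms(4) R Infinity by (simp add: mobius_rel_def)
  have "x'' * (M' $$ (1,0) * p + M' $$ (1,1) * s) = w'' * (M' $$ (0,0) * p + M' $$ (0,1) * s)"
    using arg_cong[OF 2, of "\<lambda>z. z * p"] by (simp add: 1 algebra_simps)
  then show ?thesis
    using assms(1,2) P R
    by (simp add: mobius_rel_def mult_mat_2_index p_def s_def algebra_simps del: index_mult_mat)
qed

lemma mobius_rel_unique:
  assumes M: "M \<in> carrier_mat 2 2" "det M \<noteq> 0" and "mobius_rel M P Q" "mobius_rel M P R"
  shows "Q = R"
proof -
  obtain x w where P: "hom_coords P = (x, w)" by fastforce
  have xw: "(x, w) \<noteq> (0, 0)" using P by (cases P) auto
  define p where "p = M $$ (0,0) * x + M $$ (0,1) * w"
  define s where "s = M $$ (1,0) * x + M $$ (1,1) * w"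
  have "complex_of_real (det M) \<noteq> 0" using M by simp
  moreover have "det M * x = M $$ (1,1) * p - M $$ (0,1) * s"
    "det M * w = M $$ (0,0) * s - M $$ (1,0) * p"
    unfolding det_2[OF M(1)] p_def s_def by (simp_all add: algebra_simps)
  ultimately have "(p, s) \<noteq> (0, 0)" using xw by auto
  then show ?thesis using assms(3,4)
    by (cases Q; cases R) (auto simp: mobius_rel_def P p_def[symmetric] s_def[symmetric] simp del: One_nat_def)
qed

text \<open>The affine fixed points are the roots of a polynomial of degree at most two.\<close>

lemma infinite_fixed_points_imp_scalar:
  assumes "infinite {P. mobius_rel M P P}"
  shows "M $$ (0,1) = 0" "M $$ (1,0) = 0" "M $$ (0,0) = M $$ (1,1)"
proof -
  let ?q = "[:- complex_of_real (M $$ (0,1)), M $$ (1,1) - M $$ (0,0), M $$ (1,0):]"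
  have "{P. mobius_rel M P P} \<subseteq> insert Infinity (Affine ` {z. poly ?q z = 0})"
  proof
    fix P assume "P \<in> {P. mobius_rel M P P}"
    then show "P \<in> insert Infinity (Affine ` {z. poly ?q z = 0})"
      by (cases P) (auto simp: mobius_rel_def algebra_simps)
  qed
  then have "infinite {z. poly ?q z = 0}"
    using assms finite_subset by blast
  then have "?q = 0" using poly_roots_finite by blast
  then show "M $$ (0,1) = 0" "M $$ (1,0) = 0" "M $$ (0,0) = M $$ (1,1)"
    by (simp_all flip: of_real_diff)
qed

section \<open>The two roots and their Moebius transformations\<close>

text \<open>
  The standing inequality \<open>\<bar>a + e\<bar> < 1\<close> bounds \<open>4ae\<close>, since \<open>4ae\<close> is at most \<open>(a + e)\<^sup>2\<close>; hence both
  roots \<open>k\<close> are real.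
\<close>

lemma standing_ineq_isogonal_discriminant:
  assumes "standing_ineq a 0 0 e"
  shows "4*a*e < 1"
proof -
  have "\<bar>a + e\<bar> < 1"
    using assms by (simp add: standing_ineq_def abs_if split: if_splits)
  then have "(a + e)^2 < 1" by (simp add: abs_square_less_1)
  moreover have "4*a*e = (a + e)^2 - (a - e)^2"
    by (simp add: power2_eq_square algebra_simps)
  ultimately show ?thesis
    using zero_le_power2[of "a - e"] by linarith
qed

lemma k_root_quadratic:
  assumes "standing_ineq a 0 0 e" "a \<noteq> 0" "\<sigma> \<in> {-1, 1}"
  shows "a * (k_root \<sigma> a e)^2 + k_root \<sigma> a e + e = 0"
proof -
  have "(sqrt (1 - 4*a*e))^2 = 1 - 4*a*e"
    using standing_ineq_isogonal_discriminant[OF assms(1)] by simp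
  then show ?thesis
    using assms(2,3) by (auto simp: k_root_def field_simps power2_eq_square)
qed

text \<open>A root \<open>k = \<plusminus>1\<close> would give \<open>a + e = -k\<close>, on the boundary of the standing inequality.\<close>

lemma k_root_sq_neq_1:
  assumes "standing_ineq a 0 0 e" "a \<noteq> 0" "\<sigma> \<in> {-1, 1}"
  shows "(k_root \<sigma> a e)^2 \<noteq> 1"
proof
  assume *: "(k_root \<sigma> a e)^2 = 1"
  then have "\<bar>k_root \<sigma> a e\<bar> = 1" by (auto simp: power2_eq_1_iff)
  moreover have "a + e = - k_root \<sigma> a e"
    using k_root_quadratic[OF assms] * by simp
  ultimately have "\<bar>a + e\<bar> = 1" by simp
  then show False using assms(1) by (simp add: standing_ineq_def abs_if split: if_splits)
qed

lemma N_mat_carrier [simp]: "N_mat k f \<in> carrier_mat 2 2"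
  by (simp add: N_mat_def mat_of_rows_list_def numeral_2_eq_2)

lemma N_mat_index [simp]:
  "N_mat k f $$ (0,0) = -2*f" "N_mat k f $$ (0,1) = k*(1 - f^2)"
  "N_mat k f $$ (1,0) = 1 - f^2" "N_mat k f $$ (1,1) = 2*k*f"
  "N_mat k f $$ (0,Suc 0) = k*(1 - f^2)"
  "N_mat k f $$ (Suc 0,0) = 1 - f^2" "N_mat k f $$ (Suc 0,Suc 0) = 2*k*f"
  by (simp_all add: N_mat_def mat_of_rows_list_def)

lemma det_N_mat: "det (N_mat k f) = -k * (1 + f^2)^2"
  by (simp add: det_2 power2_eq_square algebra_simps)

lemma det_N_mat_nonzero: "k \<noteq> 0 \<Longrightarrow> det (N_mat k f) \<noteq> 0"
  using sum_power2_gt_zero_iff[of 1 f] by (simp add: det_N_mat)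

text \<open>
  The two roots factor the quadratic form of \<open>bihom_eval_G_poly\<close>, so at a zero of \<open>G\<close> one of the
  two linear factors vanishes; vanishing of the factor of \<open>k\<close> is the relation given by \<open>N_mat k f\<close>.
\<close>

lemma G_zero_imp_mobius_rel:
  assumes "standing_ineq a 0 0 e" "a \<noteq> 0"
    and "bihom_eval (G_poly a 0 0 e f) P Q = 0"
  shows "\<exists>\<sigma>\<in>{-1, 1}. mobius_rel (N_mat (k_root \<sigma> a e) f) P Q"
proof -
  obtain x w where P: "hom_coords P = (x, w)" by fastforce
  obtain x' w' where Q: "hom_coords Q = (x', w')" by fastforce
  define c d :: complex where "c = of_real (1 - f^2)" and "d = of_real (2*f)"
  define X Y where "X = x * (c*x' + d*w')" and "Y = w * (c*w' - d*x')"
  define k l where "k = k_root 1 a e" and "l = k_root (-1) a e"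
  have k: "a * k^2 + k + e = 0"
    using k_root_quadratic[OF assms(1,2), of 1] by (simp add: k_def)
  have kl: "a * (k + l) = -1"
    using assms(2) by (simp add: k_def l_def k_root_def field_simps)
  have "a * (k * l) = k * (a * (k + l)) - a * k^2"
    by (simp add: algebra_simps power2_eq_square)
  also have "\<dots> = e" using k unfolding kl by simp
  finally have kl': "a * (k * l) = e" .
  have "a * ((X - k*Y) * (X - l*Y)) = a * X^2 - of_real (a * (k+l)) * (X*Y) + of_real (a*(k*l)) * Y^2"
    by (simp add: algebra_simps power2_eq_square)
  also have "\<dots> = 0"
    unfolding kl kl' using bihom_eval_G_poly[OF assms(2) P Q, of e f] assms(3)
    by (simp add: X_def Y_def c_def d_def)
  finally have "X = k*Y \<or> X = l*Y" using assms(2) by auto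
  moreover have "mobius_rel (N_mat k f) P Q" if "X = k*Y" for k :: real
    using that by (simp add: mobius_rel_def P Q X_def Y_def c_def d_def algebra_simps)
  ultimately show ?thesis unfolding k_def l_def by auto
qed

section \<open>The cyclic chain\<close>

lemma exhaust_4: "i = 1 \<or> i = 2 \<or> i = 3 \<or> i = (4::4)"
proof (cases i)
  case (of_int z)
  then have "z = 0 \<or> z = 1 \<or> z = 2 \<or> z = 3" by auto
  then show ?thesis using of_int by auto
qed

lemma successor_4: "(1::4) + 1 = 2" "(2::4) + 1 = 3" "(3::4) + 1 = 4" "(4::4) + 1 = 1"
  by simp_all

text \<open>
  As each step is a bijection of the projective line, a closed chain is determined by its first
  point, and that point is fixed by the composite of the four steps.
\<close>

lemma infinite_closed_chains_imp_scalar: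
  fixes N :: "4 \<Rightarrow> real mat"
  assumes carrier: "\<And>i. N i \<in> carrier_mat 2 2" and det: "\<And>i. det (N i) \<noteq> 0"
    and inf: "infinite {x. \<forall>i. mobius_rel (N i) (x i) (x (i + 1))}"
  defines "C \<equiv> N 4 * (N 3 * N 2 * N 1)"
  shows "C $$ (0,1) = 0" "C $$ (1,0) = 0" "C $$ (0,0) = C $$ (1,1)"
proof -
  let ?X = "{x. \<forall>i. mobius_rel (N i) (x i) (x (i + 1))}"
  have "inj_on (\<lambda>x. x 1) ?X"
  proof (rule inj_onI, rule ext)
    fix x y i assume xy: "x \<in> ?X" "y \<in> ?X" "x 1 = y 1"
    have step: "x (i + 1) = y (i + 1)" if "x i = y i" for i
      using mobius_rel_unique[OF carrier det] xy that by (metis (no_types, lifting) mem_Collect_eq)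
    have "x 2 = y 2" "x 3 = y 3" "x 4 = y 4"
      using step[of 1] step[of 2] step[of 3] xy(3) unfolding successor_4 by blast+
    then show "x i = y i" using exhaust_4[of i] xy(3) by blast
  qed
  then have "infinite ((\<lambda>x. x 1) ` ?X)"
    using inf finite_imageD by blast
  moreover have "(\<lambda>x. x 1) ` ?X \<subseteq> {P. mobius_rel C P P}"
  proof clarsimp
    fix x assume "\<forall>i. mobius_rel (N i) (x i) (x (i + 1))"
    then have "mobius_rel (N 1) (x 1) (x 2)" "mobius_rel (N 2) (x 2) (x 3)"
      "mobius_rel (N 3) (x 3) (x 4)" "mobius_rel (N 4) (x 4) (x 1)"
      by (metis successor_4)+
    then have "mobius_rel (N 4 * (N 3 * (N 2 * N 1))) (x 1) (x 1)"
      by (intro mobius_rel_mult mult_carrier_mat[of _ 2 2 _ 2] carrier)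
    then show "mobius_rel C (x 1) (x 1)"
      unfolding C_def by (simp only: assoc_mult_mat[OF carrier carrier carrier])
  qed
  ultimately have "infinite {P. mobius_rel C P P}"
    using finite_subset by blast
  then show "C $$ (0,1) = 0" "C $$ (1,0) = 0" "C $$ (0,0) = C $$ (1,1)"
    by (rule infinite_fixed_points_imp_scalar)+
qed

text \<open>
  If \<open>N T = p I\<close>, multiplication by the adjugate of \<open>N\<close> shows that \<open>T\<close> is \<open>p / det N\<close> times that
  adjugate; the factor is nonzero because \<open>T\<close> is.
\<close>

lemma scalar_product_imp_adjugate:
  fixes N T :: "'a::field mat"
  assumes carrier: "N \<in> carrier_mat 2 2" "T \<in> carrier_mat 2 2"
    and det: "det N \<noteq> 0" "det T \<noteq> 0"
    and scalar: "(N * T) $$ (0,1) = 0" "(N * T) $$ (1,0) = 0" "(N * T) $$ (0,0) = (N * T) $$ (1,1)"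
  obtains \<mu> where "\<mu> \<noteq> 0" "T $$ (0,0) = \<mu> * N $$ (1,1)" "T $$ (0,1) = - \<mu> * N $$ (0,1)"
    "T $$ (1,0) = - \<mu> * N $$ (1,0)" "T $$ (1,1) = \<mu> * N $$ (0,0)"
proof -
  define p where "p = (N * T) $$ (1,1)"
  note NT = mult_mat_2_index[OF carrier]
  have eqs: "N $$ (0,0) * T $$ (0,0) + N $$ (0,1) * T $$ (1,0) = p"
    "N $$ (0,0) * T $$ (0,1) + N $$ (0,1) * T $$ (1,1) = 0"
    "N $$ (1,0) * T $$ (0,0) + N $$ (1,1) * T $$ (1,0) = 0"
    "N $$ (1,0) * T $$ (0,1) + N $$ (1,1) * T $$ (1,1) = p"
    using scalar p_def by (simp_all add: NT del: index_mult_mat)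
  have cramer: "det N * T $$ (0,j) =
      N $$ (1,1) * (N $$ (0,0) * T $$ (0,j) + N $$ (0,1) * T $$ (1,j))
      - N $$ (0,1) * (N $$ (1,0) * T $$ (0,j) + N $$ (1,1) * T $$ (1,j))"
    "det N * T $$ (1,j) =
      N $$ (0,0) * (N $$ (1,0) * T $$ (0,j) + N $$ (1,1) * T $$ (1,j))
      - N $$ (1,0) * (N $$ (0,0) * T $$ (0,j) + N $$ (0,1) * T $$ (1,j))" for j
    unfolding det_2[OF carrier(1)] by (simp_all add: algebra_simps)
  define q where "q = p / det N"
  have "det N * T $$ (0,0) = p * N $$ (1,1)" "det N * T $$ (0,1) = - p * N $$ (0,1)"
    "det N * T $$ (1,0) = - p * N $$ (1,0)" "det N * T $$ (1,1) = p * N $$ (0,0)"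
    unfolding cramer eqs by simp_all
  then have T: "T $$ (0,0) = q * N $$ (1,1)" "T $$ (0,1) = - q * N $$ (0,1)"
    "T $$ (1,0) = - q * N $$ (1,0)" "T $$ (1,1) = q * N $$ (0,0)"
    using det(1) by (simp_all add: q_def field_simps)
  moreover have "q \<noteq> 0"
  proof
    assume "q = 0"
    then have "det T = 0" using T unfolding det_2[OF carrier(2)] by simp
    then show False using det(2) by simp
  qed
  ultimately show ?thesis using that by blast
qed

section \<open>Recovering the construction\<close>

lemma proj_ratio_eqI:
  assumes "(p, q) \<noteq> (0, 0)" "(p', q') \<noteq> (0, 0)" "p * q' = p' * q"
  shows "proj_ratio p q = proj_ratio p' q'"
  using assms by (auto simp: proj_ratio_def field_simps)

text \<open>
  The doubling formula for \<open>p / q = tan \<theta>\<close>, in homogeneous coordinates \<open>(q, p)\<close> on which doubling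
  the angle is squaring of \<open>q + i p\<close>.
\<close>

lemma tan_double_proj_ratio:
  assumes "(p, q) \<noteq> (0, 0)"
  shows "tan_double (proj_ratio p q) = proj_ratio (2*p*q) (q^2 - p^2)"
proof (cases "q = 0")
  case True
  then show ?thesis using assms by (simp add: proj_ratio_def)
next
  case False
  have "(2 * (p/q), 1 - (p/q)^2) \<noteq> (0, 0)" by auto
  moreover have "(2*p*q, q^2 - p^2) \<noteq> (0, 0)" using False by auto
  ultimately show ?thesis
    using False by (auto simp: proj_ratio_def[of p] power_divide field_simps power2_eq_square
        intro!: proj_ratio_eqI)
qed

text \<open>
  Rotation by \<open>\<theta>\<close>, mixing two row vectors, acts as a rotation by \<open>2\<theta>\<close> on the pair formed by twice
  their inner product and the difference of their squared lengths.  So if the inner product after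
  the rotation is zero, the ratio of that pair before the rotation is \<open>tan 2\<theta>\<close>; and the pair is
  nonzero before the rotation if it is nonzero afterwards, that is, if the new lengths differ.
\<close>

lemma rotation_making_rows_orthogonal:
  fixes c d u v s t :: real
  defines "u' \<equiv> c*u - d*s" and "v' \<equiv> c*v - d*t" and "s' \<equiv> d*u + c*s" and "t' \<equiv> d*v + c*t"
  assumes cd: "(c, d) \<noteq> (0, 0)" and orth: "u'*s' + v'*t' = 0"
    and len: "s'^2 + t'^2 \<noteq> u'^2 + v'^2"
  shows "(2*(u*s + v*t), s^2 + t^2 - u^2 - v^2) \<noteq> (0, 0)"
    and "tan_double (proj_ratio d c) = proj_ratio (2*(u*s + v*t)) (s^2 + t^2 - u^2 - v^2)"
proof -
  have 1: "2*d*c * (s^2 + t^2 - u^2 - v^2) = 2*(u*s + v*t) * (c^2 - d^2)"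
    using orth unfolding u'_def v'_def s'_def t'_def
    by (simp add: algebra_simps power2_eq_square)
  have 2: "s'^2 + t'^2 - (u'^2 + v'^2)
      = (c^2 - d^2) * (s^2 + t^2 - u^2 - v^2) + 2*c*d * (2*(u*s + v*t))"
    unfolding u'_def v'_def s'_def t'_def by (simp add: algebra_simps power2_eq_square)
  show 3: "(2*(u*s + v*t), s^2 + t^2 - u^2 - v^2) \<noteq> (0, 0)"
    using 2 len by auto
  have "(2*d*c, c^2 - d^2) \<noteq> (0, 0)" using cd by auto
  then show "tan_double (proj_ratio d c) = proj_ratio (2*(u*s + v*t)) (s^2 + t^2 - u^2 - v^2)"
    using tan_double_proj_ratio[of d c] proj_ratio_eqI[OF _ 3 1] cd by auto
qed

lemma N_mat_factorization:
  "mat_of_rows_list 2 [[1 - f^2, -2*f], [2*f, 1 - f^2]] * mat_of_rows_list 2 [[0, k], [1, 0]]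
    = N_mat k f"
  by (rule eq_matI)
    (auto simp: N_mat_def mat_of_rows_list_def scalar_prod_def numeral_2_eq_2 less_Suc_eq)

text \<open>
  The witness for \<open>F\<^sub>3\<close> is forced to be \<open>2f\<^sub>3 / (1 - f\<^sub>3\<^sup>2)\<close>, and the matrix \<open>T = N\<^sub>3 N\<^sub>2 N\<^sub>1\<close> has the
  entries \<open>u', v', s', t'\<close> of the construction.
\<close>

lemma infinite_closed_chains_imp_construction:
  fixes a e f \<sigma> :: "4 \<Rightarrow> real"
  assumes f: "\<And>i. f i \<in> {-1<..1}" and st: "\<And>i. standing_ineq (a i) 0 0 (e i)"
    and nz: "\<And>i. a i \<noteq> 0" "\<And>i. e i \<noteq> 0" and \<sigma>: "\<And>i. \<sigma> i \<in> {-1, 1}"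
  defines "k \<equiv> \<lambda>i. k_root (\<sigma> i) (a i) (e i)"
  defines "N \<equiv> \<lambda>i. N_mat (k i) (f i)"
  assumes inf: "infinite {x. \<forall>i. mobius_rel (N i) (x i) (x (i + 1))}"
  shows "isogonal_construction (a 1) (e 1) (a 2) (e 2) (a 3) (e 3) (a 4) (f 1) (f 2)
     (\<sigma> 1) (\<sigma> 2) (\<sigma> 3) (tan_double (Affine (f 3))) (f 3) (f 4) (e 4)"
proof -
  have k0: "k i \<noteq> 0" for i
    using k_root_quadratic[OF st[of i] nz(1)[of i] \<sigma>[of i]] nz(2)[of i] by (auto simp: k_def)
  have N [simp]: "N i \<in> carrier_mat 2 2" for i by (simp add: N_def)
  have detN: "det (N i) \<noteq> 0" for i using det_N_mat_nonzero[OF k0] by (simp add: N_def)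
  define T where "T = N 3 * N 2 * N 1"
  have T: "T \<in> carrier_mat 2 2" unfolding T_def by (intro mult_carrier_mat[of _ 2 2 _ 2] N)
  have "det T \<noteq> 0"
    using detN by (simp add: T_def det_mult[OF mult_carrier_mat[OF N N] N] det_mult[OF N N])
  then obtain \<mu> where \<mu>: "\<mu> \<noteq> 0" and Te:
    "T $$ (0,0) = \<mu> * N 4 $$ (1,1)" "T $$ (0,1) = - \<mu> * N 4 $$ (0,1)"
    "T $$ (1,0) = - \<mu> * N 4 $$ (1,0)" "T $$ (1,1) = \<mu> * N 4 $$ (0,0)"
    using scalar_product_imp_adjugate[OF N T detN]
      infinite_closed_chains_imp_scalar[OF N detN inf, folded T_def] by metis
  note Te = Te[unfolded N_def N_mat_index]

  define R where "R = mat_of_rows_list 2 [[1 - (f 3)^2, -2*f 3], [2*f 3, 1 - (f 3)^2]]"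
  define K where "K = mat_of_rows_list 2 [[0, k 3], [1, 0]]"
  define B where "B = K * N 2 * N 1"
  have RK: "R \<in> carrier_mat 2 2" "K \<in> carrier_mat 2 2"
    by (simp_all add: R_def K_def mat_of_rows_list_def numeral_2_eq_2)
  have B: "B \<in> carrier_mat 2 2" unfolding B_def by (intro mult_carrier_mat[of _ 2 2 _ 2] N RK)
  have "R * K = N 3" unfolding R_def K_def N_def by (rule N_mat_factorization)
  then have RB: "R * B = T"
    unfolding B_def T_def
    by (simp only: assoc_mult_mat[OF RK(1) mult_carrier_mat[OF RK(2) N] N, symmetric]
        assoc_mult_mat[OF RK N, symmetric])
  have R: "R $$ (0,0) = 1 - (f 3)^2" "R $$ (0,1) = -2*f 3" "R $$ (1,0) = 2*f 3" "R $$ (1,1) = 1 - (f 3)^2"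
    by (simp_all add: R_def mat_of_rows_list_def)
  define u v s t where uvst: "u = B $$ (0,0)" "v = B $$ (0,1)" "s = B $$ (1,0)" "t = B $$ (1,1)"
  let ?c = "1 - (f 3)^2" and ?d = "2 * f 3"
  have rot: "?c*u - ?d*s = T $$ (0,0)" "?c*v - ?d*t = T $$ (0,1)"
    "?d*u + ?c*s = T $$ (1,0)" "?d*v + ?c*t = T $$ (1,1)"
    unfolding RB[symmetric] uvst using RK B by (simp_all add: mult_mat_2_index R del: One_nat_def index_mult_mat)
  (* The rows of the adjugate of N 4 are orthogonal with squared lengths in the ratio
     k\<^sub>4\<^sup>2 : 1. *)
  have orth: "T $$ (0,0) * T $$ (1,0) + T $$ (0,1) * T $$ (1,1) = 0"
    unfolding Te by (simp add: algebra_simps)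
  have "(T $$ (1,0))^2 + (T $$ (1,1))^2 - ((T $$ (0,0))^2 + (T $$ (0,1))^2)
      = \<mu>^2 * (1 + (f 4)^2)^2 * (1 - (k 4)^2)"
    unfolding Te by (simp add: algebra_simps power2_eq_square)
  moreover have "(k 4)^2 \<noteq> 1" using k_root_sq_neq_1[OF st[of 4] nz(1)[of 4] \<sigma>[of 4]] by (simp add: k_def)
  moreover have "1 + (f 4)^2 \<noteq> 0" using zero_le_power2[of "f 4"] by linarith
  ultimately have len: "(T $$ (1,0))^2 + (T $$ (1,1))^2 \<noteq> (T $$ (0,0))^2 + (T $$ (0,1))^2"
    using \<mu> by auto
  have cd: "(?c, ?d) \<noteq> (0, 0)" by (rule half_angle_nonzero)
  note A = rotation_making_rows_orthogonal[OF cd, of u s v t, unfolded rot, OF orth len]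

  (* The entry s' is a multiple of 1 - f\<^sub>4\<^sup>2, so the second branch is the case f\<^sub>4 = 1;
     f\<^sub>4 = -1 is outside the range. *)
  have f4: "(f 4)^2 = 1 \<longleftrightarrow> f 4 = 1" using f[of 4] by (auto simp: power2_eq_1_iff)
  have k4F4: "(if T $$ (1,0) \<noteq> 0 then (T $$ (0,1) / T $$ (1,0), Affine (T $$ (1,1) / T $$ (1,0)))
       else (- T $$ (0,0) / T $$ (1,1), Infinity)) = (k 4, tan_double (Affine (f 4)))"
    unfolding Te using \<mu> f4 by (auto simp: proj_ratio_def field_simps)
  have e4: "e 4 = - a 4 * (k 4)^2 - k 4"
    using k_root_quadratic[OF st[of 4] nz(1)[of 4] \<sigma>[of 4]] by (simp add: k_def)
  have kf: "k i = k_root (\<sigma> i) (a i) (e i)" for i by (simp add: k_def)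
  have Nf: "N i = N_mat (k i) (f i)" for i by (simp add: N_def)
  show ?thesis
    unfolding isogonal_construction_def Let_def
    unfolding kf[symmetric] R_def[symmetric] K_def[symmetric] Nf[symmetric] B_def[symmetric] RB
      uvst[symmetric] k4F4 prod.case e4[symmetric]
    using f st nz \<sigma> A by simp
qed

theorem proposition5p2:
  fixes a b c e f :: "4 \<Rightarrow> real"
  assumes "\<And>i. f i \<in> {-1<..1}"
    and "\<And>i. standing_ineq (a i) (b i) (c i) (e i)"
    and "isogonal_matching a b c e f"
  shows "\<exists>\<sigma>1 \<sigma>2 \<sigma>3 F3.
           isogonal_construction (a 1) (e 1) (a 2) (e 2) (a 3) (e 3) (a 4) (f 1) (f 2)
             \<sigma>1 \<sigma>2 \<sigma>3 F3 (f 3) (f 4) (e 4)"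
proof -
  have bc: "b i = 0" "c i = 0" and nz: "a i \<noteq> 0" "e i \<noteq> 0" for i
    using assms(3) by (auto simp: isogonal_matching_def)
  have st: "standing_ineq (a i) 0 0 (e i)" for i
    using assms(2)[of i] by (simp add: bc)
  let ?S = "PiE UNIV (\<lambda>_. {-1, 1}) :: (4 \<Rightarrow> real) set"
  let ?X = "\<lambda>\<sigma>. {x. \<forall>i. mobius_rel (N_mat (k_root (\<sigma> i) (a i) (e i)) (f i)) (x i) (x (i + 1))}"
  (* Sort the zeros by the sign of the root used at each of the four steps. *)
  have "zero_set a b c e f \<subseteq> (\<Union>\<sigma>\<in>?S. ?X \<sigma>)"
  proof
    fix x assume "x \<in> zero_set a b c e f"
    then have "\<forall>i. \<exists>\<sigma>\<in>{-1, 1}. mobius_rel (N_mat (k_root \<sigma> (a i) (e i)) (f i)) (x i) (x (i + 1))"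
      using G_zero_imp_mobius_rel[OF st nz(1)] by (simp add: zero_set_def bc)
    then obtain \<sigma> where "\<forall>i. \<sigma> i \<in> {-1, 1} \<and>
        mobius_rel (N_mat (k_root (\<sigma> i) (a i) (e i)) (f i)) (x i) (x (i + 1))"
      by metis
    then show "x \<in> (\<Union>\<sigma>\<in>?S. ?X \<sigma>)" by auto
  qed
  moreover have "infinite (zero_set a b c e f)"
    using assms(3) by (simp add: isogonal_matching_def matching_def)
  moreover have "finite ?S" by (intro finite_PiE) auto
  ultimately have "\<exists>\<sigma>\<in>?S. infinite (?X \<sigma>)"
    by (meson finite_UN_I finite_subset)
  then obtain \<sigma> where "\<sigma> \<in> ?S" "infinite (?X \<sigma>)" ..
  then have "isogonal_construction (a 1) (e 1) (a 2) (e 2) (a 3) (e 3) (a 4) (f 1) (f 2)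
     (\<sigma> 1) (\<sigma> 2) (\<sigma> 3) (tan_double (Affine (f 3))) (f 3) (f 4) (e 4)"
    by (intro infinite_closed_chains_imp_construction assms(1) st nz) auto
  then show ?thesis by blast
qed

end
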